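(* Let $X$ be an upper compactly convex subset of a linear topological space $L$. Then the closure of $X$ in $L$ is locally compact.
   Context: Linear topological spaces are over the reals and Hausdorff. For a topological space $X$, $\exp(X)$ denotes the set of all non-empty compact subsets of $X$. A map $\Phi:X\to\exp(X)$ is called upper semi-continuous if it is continuous with respect to the topology on $\exp(X)$ generated by the base consisting of the sets $\{K\in\exp(X):K\subset U\}$, where $U$ runs over the open subsets of $X$. For points $x,y$ of $L$, $[x,y]=\{(1-t)x+ty:t\in[0,1]\}$. A convex subset $X$ of a linear topological space (with the subspace topology) is called upper compactly convex if there is an upper semi-continuous map $\Phi:X\to\exp(X)$ such that $[x,y]\subset\Phi(x)\cup\Phi(y)$ for all $x,y\in X$. *)

theory Defs
  imports "HOL-Analysis.Analysis"
begin

class linear_topological_space = real_vector + t2_space + topological_ab_group_add +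
  assumes tendsto_scaleR_Pair:
    "LIM x (nhds r \<times>\<^sub>F nhds a). fst x *\<^sub>R snd x :> nhds (r *\<^sub>R a)"

instance real_normed_vector \<subseteq> linear_topological_space
proof
  fix r :: real and a :: 'a
  have "((\<lambda>x. fst x *\<^sub>R snd x) \<longlongrightarrow> fst (r, a) *\<^sub>R snd (r, a)) (nhds (r, a))"
    by (intro tendsto_scaleR tendsto_fst tendsto_snd filterlim_ident)
  then show "LIM x (nhds r \<times>\<^sub>F nhds a). fst x *\<^sub>R snd x :> nhds (r *\<^sub>R a)"
    by (simp add: nhds_prod)
qed

text \<open>
  The space of non-empty compact subsets, and its upper topology. The generating sets are closed under
  finite intersections, so they form a base of the generated topology.
\<close>

definition compact_exp :: "'a topology \<Rightarrow> 'a set set"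
  where "compact_exp T = {K. K \<noteq> {} \<and> compactin T K}"

definition upper_exp_topology :: "'a topology \<Rightarrow> 'a set topology"
  where "upper_exp_topology T =
    topology_generated_by {{K \<in> compact_exp T. K \<subseteq> U} | U. openin T U}"

lemma topspace_upper_exp_topology: "topspace (upper_exp_topology T) = compact_exp T"
proof -
  have "\<Union> {{K \<in> compact_exp T. K \<subseteq> U} | U. openin T U} = compact_exp T"
  proof
    have "compact_exp T = {K \<in> compact_exp T. K \<subseteq> topspace T}"
      by (auto simp: compact_exp_def dest: compactin_subset_topspace)
    then show "compact_exp T \<subseteq> \<Union> {{K \<in> compact_exp T. K \<subseteq> U} | U. openin T U}"
      using openin_topspace[of T] by blast
  qed blast
  then show ?thesis
    by (simp add: upper_exp_topology_def)
qed

definition upper_semicontinuous_map :: "'a topology \<Rightarrow> ('a \<Rightarrow> 'a set) \<Rightarrow> bool"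
  where "upper_semicontinuous_map T \<Phi> \<longleftrightarrow> continuous_map T (upper_exp_topology T) \<Phi>"

definition upper_compactly_convex :: "'a::linear_topological_space set \<Rightarrow> bool"
  where "upper_compactly_convex X \<longleftrightarrow> convex X \<and>
    (\<exists>\<Phi>. upper_semicontinuous_map (top_of_set X) \<Phi> \<and>
         (\<forall>x\<in>X. \<forall>y\<in>X. closed_segment x y \<subseteq> \<Phi> x \<union> \<Phi> y))"

end

theory Submission
  imports Defs
begin

text \<open>
  Let \<open>\<Phi>\<close> witness that \<open>X\<close> is upper compactly convex, and let \<open>\<Psi> c\<close> be the compact set of all points
  whose midpoint with \<open>c\<close> lies in \<open>\<Phi> c\<close>. Since the midpoint of \<open>c\<close> and \<open>y\<close> lies in \<open>\<Phi> c \<union> \<Phi> y\<close>, always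
  \<open>y \<in> \<Psi> c\<close> or \<open>c \<in> \<Psi> y\<close>. Fix \<open>x \<in> X\<close>. Either \<open>X \<subseteq> \<Psi> x\<close>, or some \<open>c \<in> X\<close> lies outside \<open>\<Psi> x\<close>; in
  the second case, upper semicontinuity gives \<open>c \<notin> \<Psi> y\<close>, and hence \<open>y \<in> \<Psi> c\<close>, for all \<open>y \<in> X\<close>
  near \<open>x\<close>. In both cases a neighbourhood of \<open>x\<close> in \<open>X\<close> lies in a compact set of the ambient space
  (\<open>compact_cover_at_point\<close>).

  A contraction of \<open>X\<close> towards \<open>x\<close> by a small factor moves a neighbourhood of any given \<open>q\<close>
  into the good neighbourhood of \<open>x\<close>, so every point of the ambient space has the same property
  (\<open>compact_cover_transfer\<close>). Compact sets are closed, so the closure of \<open>X\<close> is locally covered by the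
  same compact sets (\<open>locally_compact_closure\<close>).
\<close>

lemma tendsto_scaleR_lts:
  fixes g :: "'b \<Rightarrow> 'a::linear_topological_space"
  assumes "(f \<longlongrightarrow> r) F" "(g \<longlongrightarrow> a) F"
  shows "((\<lambda>x. f x *\<^sub>R g x) \<longlongrightarrow> r *\<^sub>R a) F"
  using filterlim_compose[OF tendsto_scaleR_Pair filterlim_Pair[OF assms]] by simp

lemma continuous_on_scaleR_lts:
  fixes g :: "'b::topological_space \<Rightarrow> 'a::linear_topological_space"
  assumes "continuous_on S f" "continuous_on S g"
  shows "continuous_on S (\<lambda>x. f x *\<^sub>R g x)"
  using assms unfolding continuous_on_def by (auto intro: tendsto_scaleR_lts)

lemma Hausdorff_space_euclidean_t2: "Hausdorff_space (euclidean :: 'a::t2_space topology)"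
proof -
  have "\<exists>U V. open U \<and> open V \<and> x \<in> U \<and> y \<in> V \<and> disjnt U V" if "x \<noteq> y" for x y :: 'a
    using hausdorff[OF that] by (simp add: disjnt_def)
  then show ?thesis
    by (simp add: Hausdorff_space_def)
qed

lemma upper_semicontinuous_map_nhd:
  assumes usc: "upper_semicontinuous_map (top_of_set X) \<Phi>"
    and "x \<in> X" "open U" "\<Phi> x \<subseteq> U"
  obtains W where "open W" "x \<in> W" "\<And>y. y \<in> X \<inter> W \<Longrightarrow> \<Phi> y \<subseteq> U"
proof -
  let ?T = "top_of_set X"
  let ?B = "{K \<in> compact_exp ?T. K \<subseteq> X \<inter> U}"
  have cont: "continuous_map ?T (upper_exp_topology ?T) \<Phi>"
    using usc by (simp add: upper_semicontinuous_map_def)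
  have "openin (upper_exp_topology ?T) ?B"
    unfolding upper_exp_topology_def
    by (rule topology_generated_by_Basis) (use \<open>open U\<close> in blast)
  from openin_continuous_map_preimage[OF cont this]
  have "openin ?T {y \<in> X. \<Phi> y \<in> ?B}"
    by simp
  then obtain W where W: "open W" "{y \<in> X. \<Phi> y \<in> ?B} = X \<inter> W"
    by (auto simp: openin_open)
  have "\<Phi> x \<in> compact_exp ?T"
    using continuous_map_funspace[OF cont] \<open>x \<in> X\<close>
    by (auto simp: topspace_upper_exp_topology)
  then have "\<Phi> x \<in> ?B"
    using \<open>\<Phi> x \<subseteq> U\<close> by (auto simp: compact_exp_def compactin_subtopology)
  then show thesis
    using W \<open>x \<in> X\<close> by (intro that[of W]) blast+
qed

lemma upper_semicontinuous_map_compact: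
  assumes "upper_semicontinuous_map (top_of_set X) \<Phi>" "x \<in> X"
  shows "compact (\<Phi> x)"
proof -
  have "\<Phi> x \<in> compact_exp (top_of_set X)"
    using assms continuous_map_funspace[of "top_of_set X" _ \<Phi>]
    by (fastforce simp: upper_semicontinuous_map_def topspace_upper_exp_topology)
  then show ?thesis
    by (auto simp: compact_exp_def compactin_subtopology)
qed

lemma continuous_on_midpoint_lts:
  fixes c :: "'a::linear_topological_space"
  shows "continuous_on S (midpoint c)"
  unfolding midpoint_def by (intro continuous_on_scaleR_lts continuous_intros)

text \<open>
  The set \<open>midpoint c -` K\<close> is the image of \<open>K\<close> under the reflection \<open>k \<mapsto> 2 k - c\<close>.
\<close>

lemma compact_midpoint_vimage:
  fixes c :: "'a::linear_topological_space"
  assumes "compact K"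
  shows "compact (midpoint c -` K)"
proof -
  have "z = 2 *\<^sub>R midpoint c z - c" for z
    by (simp add: midpoint_def)
  moreover have "midpoint c (2 *\<^sub>R k - c) = k" for k
    by (simp add: midpoint_def)
  ultimately have "midpoint c -` K = (\<lambda>k. 2 *\<^sub>R k - c) ` K"
    by (fastforce simp: image_iff)
  moreover have "continuous_on K (\<lambda>k. 2 *\<^sub>R k - c)"
    by (intro continuous_on_scaleR_lts continuous_intros)
  ultimately show ?thesis
    using compact_continuous_image assms by metis
qed

text \<open>
  If \<open>midpoint x -` \<Phi> x\<close> does not already cover \<open>X\<close>, it misses some \<open>c \<in> X\<close>. Disjoint neighbourhoods of
  \<open>\<Phi> x\<close> and \<open>midpoint c x\<close> then keep \<open>midpoint c y\<close> out of \<open>\<Phi> y\<close> for \<open>y\<close> near \<open>x\<close>, so the segment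
  condition forces it into \<open>\<Phi> c\<close>, and \<open>midpoint c -` \<Phi> c\<close> is the required compact set.
\<close>

lemma compact_cover_at_point:
  fixes X :: "'a::linear_topological_space set"
  assumes usc: "upper_semicontinuous_map (top_of_set X) \<Phi>"
    and seg: "\<And>x y. x \<in> X \<Longrightarrow> y \<in> X \<Longrightarrow> closed_segment x y \<subseteq> \<Phi> x \<union> \<Phi> y"
    and x: "x \<in> X"
  obtains W P where "open W" "x \<in> W" "compact P" "X \<inter> W \<subseteq> P"
proof (cases "X \<subseteq> midpoint x -` \<Phi> x")
  case True
  then show ?thesis
    using compact_midpoint_vimage[OF upper_semicontinuous_map_compact[OF usc x]]
    by (intro that[of UNIV "midpoint x -` \<Phi> x"]) auto
next
  case False
  then obtain c where c: "c \<in> X" "midpoint c x \<notin> \<Phi> x"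
    using midpoint_sym[of x] by (auto simp only: subset_eq vimage_eq)
  have "compactin euclidean (\<Phi> x)" "compactin euclidean {midpoint c x}"
    using upper_semicontinuous_map_compact[OF usc x] by (simp_all add: compactin_euclidean_iff)
  moreover have "disjnt (\<Phi> x) {midpoint c x}"
    using c by simp
  ultimately obtain G H where GH: "open G" "open H" "\<Phi> x \<subseteq> H" "midpoint c x \<in> G" "disjnt H G"
    using Hausdorff_space_compact_separation[OF Hausdorff_space_euclidean_t2]
    by (metis insert_subset open_openin)
  obtain W where W: "open W" "x \<in> W" "\<And>y. y \<in> X \<inter> W \<Longrightarrow> \<Phi> y \<subseteq> H"
    using upper_semicontinuous_map_nhd[OF usc x GH(2,3)] by metis
  have "y \<in> midpoint c -` \<Phi> c" if y: "y \<in> X \<inter> (W \<inter> midpoint c -` G)" for y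
  proof -
    have "midpoint c y \<in> \<Phi> c \<union> \<Phi> y"
      using seg[OF c(1)] y midpoint_in_closed_segment by blast
    moreover have "midpoint c y \<notin> \<Phi> y"
      using W(3)[of y] y GH(5) by (auto simp: disjnt_iff)
    ultimately show ?thesis
      by simp
  qed
  moreover have "open (W \<inter> midpoint c -` G)"
    using W(1) open_vimage[OF GH(1) continuous_on_midpoint_lts] by auto
  ultimately show ?thesis
    using W(2) GH(4) compact_midpoint_vimage[OF upper_semicontinuous_map_compact[OF usc c(1)]]
    by (intro that[of "W \<inter> midpoint c -` G" "midpoint c -` \<Phi> c"]) auto
qed

text \<open>
  Pull the neighbourhood of \<open>x\<close> and its compact cover back along the contraction
  \<open>z \<mapsto> x + t (z - x)\<close>: it preserves \<open>X\<close>, is invertible, and for small \<open>t > 0\<close> maps \<open>q\<close> near \<open>x\<close>.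
\<close>

lemma compact_cover_transfer:
  fixes X :: "'a::linear_topological_space set"
  assumes "convex X" "x \<in> X" "open W" "x \<in> W" "compact P" "X \<inter> W \<subseteq> P"
  obtains V Q where "open V" "q \<in> V" "compact Q" "X \<inter> V \<subseteq> Q"
proof -
  have "((\<lambda>t. x + t *\<^sub>R (q - x)) \<longlongrightarrow> x + 0 *\<^sub>R (q - x)) (at_right (0::real))"
    by (intro tendsto_add tendsto_scaleR_lts tendsto_const tendsto_ident_at)
  then have "\<forall>\<^sub>F t in at_right (0::real). x + t *\<^sub>R (q - x) \<in> W"
    using assms by (intro topological_tendstoD) auto
  moreover have "\<forall>\<^sub>F t in at_right (0::real). 0 < t \<and> t < 1"
    by (auto simp: eventually_at_right_field intro!: exI[of _ 1])
  ultimately have "\<forall>\<^sub>F t in at_right (0::real). x + t *\<^sub>R (q - x) \<in> W \<and> 0 < t \<and> t < 1"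
    by eventually_elim auto
  then obtain t :: real where t: "x + t *\<^sub>R (q - x) \<in> W" "0 < t" "t < 1"
    using eventually_happens'[OF trivial_limit_at_right_real] by blast
  define h where "h z = x + t *\<^sub>R (z - x)" for z
  define g where "g z = x + (1/t) *\<^sub>R (z - x)" for z
  have cont: "continuous_on S h" "continuous_on S g" for S
    unfolding h_def g_def by (intro continuous_intros continuous_on_scaleR_lts)+
  have "h z \<in> X" if "z \<in> X" for z
    using convexD_alt[OF \<open>convex X\<close> \<open>x \<in> X\<close> that, of t] t by (simp add: h_def algebra_simps)
  moreover have "g (h z) = z" for z
    using t by (simp add: h_def g_def)
  ultimately have "X \<inter> h -` W \<subseteq> g ` P"
    using \<open>X \<inter> W \<subseteq> P\<close> by (auto simp: image_iff) (metis IntI subsetD)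
  moreover have "open (h -` W)" "q \<in> h -` W"
    using open_vimage[OF \<open>open W\<close> cont(1)] t by (auto simp: h_def)
  moreover have "compact (g ` P)"
    using compact_continuous_image[OF cont(2) \<open>compact P\<close>] .
  ultimately show ?thesis
    using that by blast
qed

lemma locally_compact_closure:
  fixes X :: "'a::t2_space set"
  assumes "\<And>q. q \<in> closure X \<Longrightarrow> \<exists>V Q. open V \<and> q \<in> V \<and> compact Q \<and> X \<inter> V \<subseteq> Q"
  shows "locally_compact_space (top_of_set (closure X))"
  unfolding locally_compact_space_def
proof
  fix q
  assume "q \<in> topspace (top_of_set (closure X))"
  then have q: "q \<in> closure X"
    by simp
  then obtain V Q where V: "open V" "q \<in> V" "compact Q" "X \<inter> V \<subseteq> Q"
    using assms by blast
  have "closure X \<inter> V \<subseteq> closure (X \<inter> V)"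
    using open_Int_closure_subset[OF V(1), of X] by (simp add: Int_commute)
  also have "\<dots> \<subseteq> Q"
    using V by (intro closure_minimal compact_imp_closed)
  finally have "closure X \<inter> V \<subseteq> closure X \<inter> Q"
    by blast
  moreover have "compactin (top_of_set (closure X)) (closure X \<inter> Q)"
    using V by (simp add: compactin_subtopology compactin_euclidean_iff closed_Int_compact)
  moreover have "openin (top_of_set (closure X)) (closure X \<inter> V)"
    using V by blast
  ultimately show "\<exists>U K. openin (top_of_set (closure X)) U \<and>
      compactin (top_of_set (closure X)) K \<and> q \<in> U \<and> U \<subseteq> K"
    using q V by blast
qed

theorem corollary3:
  fixes X :: "'a::linear_topological_space set"
  assumes "upper_compactly_convex X"
  shows "locally_compact_space (top_of_set (closure X))"
proof (rule locally_compact_closure)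
  fix q
  assume "q \<in> closure X"
  then obtain x where x: "x \<in> X"
    by fastforce
  obtain \<Phi> where \<Phi>: "convex X" "upper_semicontinuous_map (top_of_set X) \<Phi>"
    "\<And>x y. x \<in> X \<Longrightarrow> y \<in> X \<Longrightarrow> closed_segment x y \<subseteq> \<Phi> x \<union> \<Phi> y"
    using assms by (auto simp: upper_compactly_convex_def)
  obtain W P where "open W" "x \<in> W" "compact P" "X \<inter> W \<subseteq> P"
    using compact_cover_at_point[OF \<Phi>(2,3) x] by metis
  then show "\<exists>V Q. open V \<and> q \<in> V \<and> compact Q \<and> X \<inter> V \<subseteq> Q"
    using compact_cover_transfer[OF \<Phi>(1) x] by metis
qed

end
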